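(* Let $t\ge 1$, let $\ell_1,\dots,\ell_t$ be distinct positive integers and set $\mathcal L=\{2\ell_1,\dots,2\ell_t\}$. Then there exists $n_0=n_0(\mathcal L)$ such that, for every $n\ge n_0$, every family $\mathcal F\subseteq H=\{A\subseteq[n]: |A|\text{ is even}\}$ satisfying $|A\triangle B|\in\mathcal L$ for all $A\ne B$ in $\mathcal F$ has $$|\mathcal F|\le \sum_{i=0}^{t}\binom{n-1}{i}.$$ Moreover, for $\mathcal L=\{2,4,\dots,2t\}$, equality is attained: for every $n\ge n_0(\mathcal L)$ there is a family $\mathcal F\subseteq H$ with $|A\triangle B|\in\{2,4,\dots,2t\}$ for all $A\ne B$ in $\mathcal F$ and $|\mathcal F|=\sum_{i=0}^{t}\binom{n-1}{i}$.
   Context: Here $[n]=\{1,\dots,n\}$ and $\triangle$ denotes symmetric difference of sets. The set $H$ of even-size subsets of $[n]$ is called the even subcube. *)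

theory Defs
  imports Complex_Main
begin

definition even_subcube :: "nat \<Rightarrow> nat set set" where
  "even_subcube n = {A. A \<subseteq> {1..n} \<and> even (card A)}"

definition distances_in :: "nat set set \<Rightarrow> nat set \<Rightarrow> bool" where
  "distances_in F L \<longleftrightarrow> (\<forall>A\<in>F. \<forall>B\<in>F. A \<noteq> B \<longrightarrow> card (sym_diff A B) \<in> L)"

end

theory Submission
  imports Defs
begin

text \<open>
  The upper bound is a signature argument. On \<open>F\<close> the matrix
  \<open>K(A, B) = (\<Prod>i. 4 l\<^sub>i - 2 |A \<triangle> B|)\<close> is a positive multiple of the identity. Expand \<open>K\<close> in the
  characters \<open>\<chi>\<^sub>S\<close> of the cube, of degree \<open>|S| \<le> t\<close>. Since \<open>n - 2 |D| = (\<Sum>j. \<chi>\<^sub>{\<^sub>j\<^sub>}(D))\<close>, a further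
  factor \<open>4 l - 2 |D| = (n - 2 |D|) - (n - 4 l)\<close> with \<open>n \<ge> 4 l\<close> flips the sign pattern of the
  coefficients, so the coefficient of \<open>\<chi>\<^sub>S\<close> is nonpositive unless \<open>|S|\<close> and \<open>t\<close> have the same parity.
  Hence \<open>|F|\<close> is at most the number of sets \<open>S\<close> with \<open>|S| \<le> t\<close> and \<open>|S| \<equiv> t (mod 2)\<close>, and
  forgetting the point \<open>n\<close> maps these sets bijectively to the subsets of \<open>{1..n-1}\<close> of size at
  most \<open>t\<close>. The inverse image of the same Hamming ball in the even subcube attains the bound.
\<close>

section \<open>Characters of the cube and their products\<close>

text \<open>For finite \<open>S\<close> this is the Walsh character (-1)^|S \<inter> D|. As a
  product over \<open>S\<close> it can be compared factor by factor, which makes multiplicativity in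
  \<open>D\<close> immediate.\<close>

definition cube_character :: "'a set \<Rightarrow> 'a set \<Rightarrow> real" where
  "cube_character S D = (\<Prod>j\<in>S. if j \<in> D then - 1 else 1)"

lemma cube_character_sym_diff_right:
  "cube_character S (sym_diff A B) = cube_character S A * cube_character S B"
  unfolding cube_character_def prod.distrib [symmetric] by (rule prod.cong) auto

text \<open>Multiplying by a degree-one character permutes the characters: a new point adds a
  factor, and a point already in \<open>S\<close> cancels because the factor squares to 1.\<close>

lemma cube_character_flip:
  assumes "finite S"
  shows "cube_character (sym_diff S {j}) D = cube_character {j} D * cube_character S D"
proof (cases "j \<in> S")
  case True
  then have "sym_diff S {j} = S - {j}" by auto
  moreover have "cube_character S D = cube_character {j} D * cube_character (S - {j}) D"
    unfolding cube_character_def using assms True by (simp add: prod.remove)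
  moreover have "cube_character {j} D * cube_character {j} D = 1"
    by (simp add: cube_character_def)
  ultimately show ?thesis by (simp flip: mult.assoc)
next
  case False
  then have "sym_diff S {j} = insert j S" by auto
  then show ?thesis using False assms by (simp add: cube_character_def)
qed

lemma sum_cube_character_singletons:
  assumes "finite N" "D \<subseteq> N"
  shows "(\<Sum>j\<in>N. cube_character {j} D) = real (card N) - 2 * real (card D)"
proof -
  have "(\<Sum>j\<in>N. cube_character {j} D) = (\<Sum>j\<in>N. 1 - 2 * (if j \<in> D then 1 else 0))"
    by (rule sum.cong) (auto simp: cube_character_def)
  also have "\<dots> = real (card N) - 2 * (\<Sum>j\<in>N. if j \<in> D then 1 else 0)"
    by (simp add: sum_subtractf sum_distrib_left)
  also have "(\<Sum>j\<in>N. if j \<in> D then 1 else (0::real)) = real (card D)"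
    using assms by (simp add: sum.If_cases Int_absorb1)
  finally show ?thesis .
qed

text \<open>The factor on the left is the sum of the degree-one characters, and each of them toggles
  one point of the index set. Reindexing by the involution \<open>S\<close> to
  \<open>sym_diff S {j}\<close> moves the toggle to the coefficients, so the factor acts on
  \<open>f\<close> as the adjacency operator of the hypercube.\<close>

lemma distance_mult_character_sum:
  assumes N: "finite N" and D: "D \<subseteq> N"
  shows "(real (card N) - 2 * real (card D)) * (\<Sum>S\<in>Pow N. f S * cube_character S D)
    = (\<Sum>S\<in>Pow N. (\<Sum>j\<in>N. f (sym_diff S {j})) * cube_character S D)"
proof -
  have fin: "finite S" if "S \<in> Pow N" for S
    using that N finite_subset by auto
  have reindex: "(\<Sum>S\<in>Pow N. f S * cube_character (sym_diff S {j}) D)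
      = (\<Sum>S\<in>Pow N. f (sym_diff S {j}) * cube_character S D)" if "j \<in> N" for j
  proof (rule sum.reindex_bij_witness [where i = "\<lambda>S. sym_diff S {j}" and j = "\<lambda>S. sym_diff S {j}"])
    fix S assume "S \<in> Pow N"
    have flip: "sym_diff (sym_diff S {j}) {j} = S" by auto
    show "sym_diff (sym_diff S {j}) {j} = S" "sym_diff (sym_diff S {j}) {j} = S" by (rule flip)+
    show "sym_diff S {j} \<in> Pow N" "sym_diff S {j} \<in> Pow N"
      using \<open>S \<in> Pow N\<close> that by auto
    show "f (sym_diff (sym_diff S {j}) {j}) * cube_character (sym_diff S {j}) D
        = f S * cube_character (sym_diff S {j}) D"
      by (simp only: flip)
  qed
  have "(real (card N) - 2 * real (card D)) * (\<Sum>S\<in>Pow N. f S * cube_character S D)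
      = (\<Sum>j\<in>N. \<Sum>S\<in>Pow N. cube_character {j} D * (f S * cube_character S D))"
    unfolding sum_cube_character_singletons [OF assms, symmetric] by (rule sum_product)
  also have "\<dots> = (\<Sum>j\<in>N. \<Sum>S\<in>Pow N. f S * cube_character (sym_diff S {j}) D)"
    by (intro sum.cong refl, subst cube_character_flip) (auto simp: fin)
  also have "\<dots> = (\<Sum>j\<in>N. \<Sum>S\<in>Pow N. f (sym_diff S {j}) * cube_character S D)"
    by (rule sum.cong [OF refl]) (rule reindex)
  also have "\<dots> = (\<Sum>S\<in>Pow N. \<Sum>j\<in>N. f (sym_diff S {j}) * cube_character S D)"
    by (rule sum.swap)
  finally show ?thesis by (simp add: sum_distrib_right)
qed

text \<open>Used twice for neighbours in the hypercube: sizes change by at most one, which controls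
  the degree, and parity always changes, which controls the sign.\<close>

lemma card_sym_diff_singleton:
  assumes "finite S"
  shows "card (sym_diff S {j}) = Suc (card S) \<or> card S = Suc (card (sym_diff S {j}))"
proof (cases "j \<in> S")
  case True
  then have "sym_diff S {j} = S - {j}" by auto
  then show ?thesis using card_Suc_Diff1 [OF assms True] by simp
next
  case False
  then have "sym_diff S {j} = insert j S" by auto
  then show ?thesis using assms False by simp
qed

text \<open>Induction on \<open>I\<close>, writing the new factor as (n - 2|D|) - (n - c k) with n =
  \<open>card N\<close>. The first term replaces a coefficient by the sum over its neighbours, whose
  sizes have the opposite parity; the second multiplies it by -(n - c k), which is nonpositive since
  \<open>c k\<close> is at most n. Both reverse the sign pattern, as required when |I| grows by
  one.\<close>

lemma alternating_character_expansion:
  fixes c :: "'i \<Rightarrow> real"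
  assumes N: "finite N" and I: "finite I" and c: "\<And>i. i \<in> I \<Longrightarrow> c i \<le> card N"
  obtains f where
    "\<And>S. S \<subseteq> N \<Longrightarrow> card S > card I \<Longrightarrow> f S = 0"
    "\<And>S. S \<subseteq> N \<Longrightarrow> (- 1) ^ (card I + card S) * f S \<ge> 0"
    "\<And>D. D \<subseteq> N \<Longrightarrow> (\<Prod>i\<in>I. c i - 2 * real (card D)) = (\<Sum>S\<in>Pow N. f S * cube_character S D)"
  using I c
proof (induction I arbitrary: thesis rule: finite_induct)
  case empty
  show ?case
  proof (rule empty(1) [of "\<lambda>S. if S = {} then 1 else 0"])
    fix S assume "S \<subseteq> N" "card S > card ({} :: 'i set)"
    then show "(if S = {} then 1 else 0 :: real) = 0" by auto
  next
    fix S assume "S \<subseteq> N"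
    show "(- 1) ^ (card ({} :: 'i set) + card S) * (if S = {} then 1 else 0 :: real) \<ge> 0" by auto
  next
    fix D assume "D \<subseteq> N"
    have "(\<Sum>S\<in>Pow N. (if S = {} then 1 else 0) * cube_character S D)
        = (\<Sum>S\<in>Pow N. if S = {} then 1 else 0)"
      by (rule sum.cong) (auto simp: cube_character_def)
    then show "(\<Prod>i\<in>{}. c i - 2 * real (card D))
        = (\<Sum>S\<in>Pow N. (if S = {} then 1 else 0) * cube_character S D)"
      using N by simp
  qed
next
  case (insert k I)
  obtain f where deg: "\<And>S. S \<subseteq> N \<Longrightarrow> card S > card I \<Longrightarrow> f S = 0"
    and sign: "\<And>S. S \<subseteq> N \<Longrightarrow> (- 1) ^ (card I + card S) * f S \<ge> 0"
    and exp: "\<And>D. D \<subseteq> N \<Longrightarrow>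
      (\<Prod>i\<in>I. c i - 2 * real (card D)) = (\<Sum>S\<in>Pow N. f S * cube_character S D)"
    using insert.IH insert.prems(2) by auto
  define g where "g S = (\<Sum>j\<in>N. f (sym_diff S {j})) - (card N - c k) * f S" for S
  show ?case
  proof (rule insert.prems(1) [of g])
    fix S assume S: "S \<subseteq> N" "card S > card (insert k I)"
    have "f (sym_diff S {j}) = 0" if "j \<in> N" for j
    proof (rule deg)
      show "sym_diff S {j} \<subseteq> N" using S that by auto
      show "card (sym_diff S {j}) > card I"
        using card_sym_diff_singleton [OF finite_subset [OF S(1) N], of j] S(2) insert.hyps by auto
    qed
    moreover have "f S = 0" using S insert.hyps by (intro deg) auto
    ultimately show "g S = 0" by (simp add: g_def)
  next
    fix S assume S: "S \<subseteq> N"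
    have "(- 1) ^ (card (insert k I) + card S) * f (sym_diff S {j}) \<ge> 0" if "j \<in> N" for j
    proof -
      have "sym_diff S {j} \<subseteq> N" using S that by auto
      \<comment> \<open>Passing to \<open>insert k I\<close> and to a neighbour of \<open>S\<close>
        changes both summands by one, so the induction hypothesis at the neighbour has exactly the
        sign wanted here.\<close>
      moreover have "even (card (insert k I) + card S) = even (card I + card (sym_diff S {j}))"
        using card_sym_diff_singleton [OF finite_subset [OF S N], of j] insert.hyps by auto
      ultimately show ?thesis using sign [of "sym_diff S {j}"] by (auto simp: minus_one_power_iff)
    qed
    then have "(\<Sum>j\<in>N. (- 1) ^ (card (insert k I) + card S) * f (sym_diff S {j})) \<ge> 0"
      by (rule sum_nonneg)
    moreover have "(card N - c k) * ((- 1) ^ (card I + card S) * f S) \<ge> 0"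
      using sign [OF S] insert.prems(2) [of k] by (intro mult_nonneg_nonneg [of "card N - c k"]) auto
    moreover have "(- 1) ^ (card (insert k I) + card S) * g S
        = (\<Sum>j\<in>N. (- 1) ^ (card (insert k I) + card S) * f (sym_diff S {j}))
          + (card N - c k) * ((- 1) ^ (card I + card S) * f S)"
      unfolding g_def sum_distrib_left [symmetric] using insert.hyps by (simp add: algebra_simps)
    ultimately show "(- 1) ^ (card (insert k I) + card S) * g S \<ge> 0" by linarith
  next
    fix D assume D: "D \<subseteq> N"
    have "(\<Prod>i\<in>insert k I. c i - 2 * real (card D))
        = ((real (card N) - 2 * real (card D)) - (card N - c k))
          * (\<Sum>S\<in>Pow N. f S * cube_character S D)"
      using insert.hyps exp [OF D] by simp
    also have "\<dots> = (\<Sum>S\<in>Pow N. g S * cube_character S D)"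
      unfolding left_diff_distrib [of "real (card N) - 2 * real (card D)"]
        distance_mult_character_sum [OF N D]
      unfolding g_def left_diff_distrib [of "\<Sum>j\<in>N. f (sym_diff _ {j})"] sum_subtractf
      by (simp add: sum_distrib_left mult.assoc)
    finally show "(\<Prod>i\<in>insert k I. c i - 2 * real (card D))
        = (\<Sum>S\<in>Pow N. g S * cube_character S D)" .
  qed
qed

section \<open>Linear algebra and the signature argument\<close>

lemma nontrivial_solution_homogeneous:
  fixes g :: "'i \<Rightarrow> 'b \<Rightarrow> 'a::field"
  assumes "finite T" "finite F" "card T < card F"
  shows "\<exists>a. (\<exists>x\<in>F. a x \<noteq> 0) \<and> (\<forall>s\<in>T. (\<Sum>x\<in>F. a x * g s x) = 0)"
  using assms
proof (induction T arbitrary: F g rule: finite_induct)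
  case empty
  then have "F \<noteq> {}" by auto
  then show ?case by (intro exI [of _ "\<lambda>_. 1"]) auto
next
  case (insert s T)
  show ?case
  proof (cases "\<forall>x\<in>F. g s x = 0")
    case True
    with insert.IH [of F g] insert.prems insert.hyps show ?thesis by auto
  next
    case False
    then obtain y where y: "y \<in> F" "g s y \<noteq> 0" by blast
    \<comment> \<open>Gaussian elimination with pivot \<open>g s y\<close>: subtracting a multiple
      of equation \<open>s\<close> removes the unknown \<open>y\<close> from equation
      \<open>r\<close>, and turns equation \<open>s\<close> itself into 0 = 0.\<close>
    define h where "h r x = g r x - g r y * g s x / g s y" for r x
    have "card T < card (F - {y})" using insert.prems insert.hyps y by (simp add: card_Diff_singleton)
    then obtain a x where x: "x \<in> F - {y}" "a x \<noteq> 0"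
      and a: "\<And>r. r \<in> T \<Longrightarrow> (\<Sum>x\<in>F - {y}. a x * h r x) = 0"
      using insert.IH [of "F - {y}" h] insert.prems by auto
    \<comment> \<open>The value at \<open>y\<close> is the one that solves equation \<open>s\<close>
      for \<open>y\<close>.\<close>
    define b where "b = a(y := - (\<Sum>x\<in>F - {y}. a x * g s x) / g s y)"
    have b: "(\<Sum>x\<in>F. b x * g r x) = (\<Sum>x\<in>F - {y}. a x * h r x)" for r
    proof -
      have "(\<Sum>x\<in>F. b x * g r x) = b y * g r y + (\<Sum>x\<in>F - {y}. b x * g r x)"
        using insert.prems y by (simp add: sum.remove)
      also have "(\<Sum>x\<in>F - {y}. b x * g r x) = (\<Sum>x\<in>F - {y}. a x * g r x)"
        by (rule sum.cong) (auto simp: b_def)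
      also have "b y * g r y = - (\<Sum>x\<in>F - {y}. a x * (g r y * g s x / g s y))"
        by (simp add: b_def sum_distrib_left sum_divide_distrib mult_ac)
      finally show ?thesis by (simp add: h_def right_diff_distrib sum_subtractf)
    qed
    have "h s = (\<lambda>_. 0)" using y by (auto simp: h_def)
    then have "\<forall>r\<in>insert s T. (\<Sum>x\<in>F. b x * g r x) = 0" using a by (simp add: b)
    moreover have "b x \<noteq> 0" "x \<in> F" using x by (auto simp: b_def)
    ultimately show ?thesis by blast
  qed
qed

text \<open>If \<open>F\<close> were larger than the set of admissible \<open>S\<close>, some
  nonzero vector \<open>a\<close> on \<open>F\<close> would be orthogonal to all their characters.
  The quadratic form of \<open>K\<close> at \<open>a\<close> is then positive, because
  \<open>K\<close> is a positive multiple of the identity on \<open>F\<close>, and also nonpositive,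
  because only characters with nonpositive coefficients survive.\<close>

lemma card_le_same_parity_sets:
  fixes d :: "'i \<Rightarrow> nat"
  assumes N: "finite N" and F: "F \<subseteq> Pow N" and I: "finite I"
    and d: "\<And>i. i \<in> I \<Longrightarrow> 0 < d i \<and> 2 * d i \<le> card N"
    and dist: "\<And>A B. A \<in> F \<Longrightarrow> B \<in> F \<Longrightarrow> A \<noteq> B \<Longrightarrow> card (sym_diff A B) \<in> d ` I"
  shows "card F \<le> card {S \<in> Pow N. even (card S + card I) \<and> card S \<le> card I}"
    (is "_ \<le> card ?T")
proof (rule ccontr)
  assume "\<not> card F \<le> card ?T"
  moreover have finF: "finite F" using N F finite_subset by auto
  ultimately obtain a A0 where A0: "A0 \<in> F" "a A0 \<noteq> 0"
    and a: "\<And>S. S \<in> ?T \<Longrightarrow> (\<Sum>A\<in>F. a A * cube_character S A) = 0"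
    using nontrivial_solution_homogeneous [of ?T F cube_character] N by auto
  have "2 * real (d i) \<le> real (card N)" if "i \<in> I" for i
    using d [OF that] by linarith
  then obtain f where deg: "\<And>S. S \<subseteq> N \<Longrightarrow> card S > card I \<Longrightarrow> f S = 0"
    and sign: "\<And>S. S \<subseteq> N \<Longrightarrow> (- 1) ^ (card I + card S) * f S \<ge> 0"
    and exp: "\<And>D. D \<subseteq> N \<Longrightarrow>
      (\<Prod>i\<in>I. 2 * real (d i) - 2 * real (card D)) = (\<Sum>S\<in>Pow N. f S * cube_character S D)"
    using alternating_character_expansion [OF N I, of "\<lambda>i. 2 * real (d i)"] by blast
  define K where "K A B = (\<Prod>i\<in>I. 2 * real (d i) - 2 * real (card (sym_diff A B)))" for A B :: "'a set"
  have K: "K A B = (if A = B then \<Prod>i\<in>I. 2 * real (d i) else 0)" if AB: "A \<in> F" "B \<in> F" for A B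
  proof (cases "A = B")
    case False
    then obtain i where "i \<in> I" "card (sym_diff A B) = d i" using dist [OF AB] by auto
    then have "K A B = 0" using I unfolding K_def by (intro prod_zero) auto
    then show ?thesis using False by simp
  qed (simp add: K_def)
  have "(\<Sum>A\<in>F. \<Sum>B\<in>F. a A * a B * K A B) = (\<Sum>A\<in>F. a A * a A * (\<Prod>i\<in>I. 2 * real (d i)))"
  proof (rule sum.cong [OF refl])
    fix A assume "A \<in> F"
    then have "(\<Sum>B\<in>F. a A * a B * K A B)
        = (\<Sum>B\<in>F. if A = B then a A * a B * (\<Prod>i\<in>I. 2 * real (d i)) else 0)"
      by (intro sum.cong) (auto simp: K)
    then show "(\<Sum>B\<in>F. a A * a B * K A B) = a A * a A * (\<Prod>i\<in>I. 2 * real (d i))"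
      using finF \<open>A \<in> F\<close> by simp
  qed
  also have "\<dots> > 0"
  proof (rule sum_pos2 [OF finF A0(1)])
    have pos: "(\<Prod>i\<in>I. 2 * real (d i)) > 0" using d by (intro prod_pos) auto
    show "a A0 * a A0 * (\<Prod>i\<in>I. 2 * real (d i)) > 0"
      using pos A0(2) by (auto simp: zero_less_mult_iff linorder_neq_iff)
    show "a A * a A * (\<Prod>i\<in>I. 2 * real (d i)) \<ge> 0" for A
      using pos by simp
  qed
  also have "(\<Sum>A\<in>F. \<Sum>B\<in>F. a A * a B * K A B)
      = (\<Sum>A\<in>F. \<Sum>B\<in>F. \<Sum>S\<in>Pow N. f S * ((a A * cube_character S A) * (a B * cube_character S B)))"
  proof (intro sum.cong refl)
    fix A B assume "A \<in> F" "B \<in> F"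
    then have D: "sym_diff A B \<subseteq> N" using F by auto
    have "K A B = (\<Sum>S\<in>Pow N. f S * (cube_character S A * cube_character S B))"
      unfolding K_def exp [OF D] cube_character_sym_diff_right ..
    then show "a A * a B * K A B
        = (\<Sum>S\<in>Pow N. f S * ((a A * cube_character S A) * (a B * cube_character S B)))"
      by (simp add: sum_distrib_left mult_ac)
  qed
  also have "\<dots> = (\<Sum>A\<in>F. \<Sum>S\<in>Pow N. \<Sum>B\<in>F.
      f S * ((a A * cube_character S A) * (a B * cube_character S B)))"
    by (intro sum.cong refl sum.swap)
  also have "\<dots> = (\<Sum>S\<in>Pow N. \<Sum>A\<in>F. \<Sum>B\<in>F.
      f S * ((a A * cube_character S A) * (a B * cube_character S B)))"
    by (rule sum.swap)
  \<comment> \<open>Since a character of \<open>sym_diff A B\<close> splits into a factor for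
    \<open>A\<close> and one for \<open>B\<close>, the double sum for each \<open>S\<close> is a
    square: the characters diagonalize the form.\<close>
  also have "\<dots> = (\<Sum>S\<in>Pow N. f S * (\<Sum>A\<in>F. a A * cube_character S A)\<^sup>2)"
    unfolding power2_eq_square sum_product by (simp only: sum_distrib_left)
  also have "\<dots> \<le> 0"
  proof (rule sum_nonpos)
    fix S assume S: "S \<in> Pow N"
    show "f S * (\<Sum>A\<in>F. a A * cube_character S A)\<^sup>2 \<le> 0"
    \<comment> \<open>Inside \<open>?T\<close> the square vanishes by the choice of
      \<open>a\<close>. Outside it, \<open>S\<close> either has the wrong parity, so
      \<open>f S\<close> is nonpositive, or exceeds the degree, so \<open>f S\<close> is 0.\<close>
    proof (cases "S \<in> ?T")
      case True
      then show ?thesis using a by simp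
    next
      case False
      have "f S \<le> 0"
      proof (cases "card S \<le> card I")
        case True
        with False S have "odd (card I + card S)" by (auto simp: add.commute)
        then show ?thesis using sign [of S] S by simp
      next
        case False
        then show ?thesis using deg [of S] S by simp
      qed
      then show ?thesis by (simp add: mult_nonpos_nonneg)
    qed
  qed
  finally show False by simp
qed

section \<open>Counting sets of prescribed parity\<close>

lemma card_bounded_subsets:
  assumes "finite N"
  shows "card {B \<in> Pow N. card B \<le> t} = (\<Sum>i=0..t. card N choose i)"
proof -
  have "{B \<in> Pow N. card B \<le> t} = (\<Union>i\<in>{0..t}. {B. B \<subseteq> N \<and> card B = i})" by auto
  also have "card \<dots> = (\<Sum>i=0..t. card {B. B \<subseteq> N \<and> card B = i})"
    using assms by (intro card_UN_disjoint) auto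
  finally show ?thesis using assms by (simp add: n_subsets)
qed

text \<open>The parity of |S| decides whether \<open>n\<close> belongs to \<open>S\<close>, so
  \<open>S - {n}\<close> determines \<open>S\<close> and can be any subset of
  \<open>{1..n - 1}\<close> of size at most \<open>t\<close>. The parameter \<open>p\<close> serves
  both uses: \<open>t\<close> for the upper bound and 0 for the extremal family.\<close>

lemma card_parity_sets:
  assumes n: "n \<ge> 1"
  shows "card {S \<in> Pow {1..n}. even (card S + p) \<and> card (S - {n}) \<le> t}
    = (\<Sum>i=0..t. (n - 1) choose i)"
    (is "card ?X = _")
proof -
  let ?Y = "{B \<in> Pow {1..n - 1}. card B \<le> t}"
  have "bij_betw (\<lambda>S. S - {n}) ?X ?Y"
  proof (rule bij_betw_byWitness [where f' = "\<lambda>B. if even (card B + p) then B else insert n B"])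
    show "\<forall>S\<in>?X. (if even (card (S - {n}) + p) then S - {n} else insert n (S - {n})) = S"
    proof
      fix S assume S: "S \<in> ?X"
      then have "finite S" by (auto intro: finite_subset)
      show "(if even (card (S - {n}) + p) then S - {n} else insert n (S - {n})) = S"
      proof (cases "n \<in> S")
        case True
        then have "card S = Suc (card (S - {n}))" using card_Suc_Diff1 [OF \<open>finite S\<close>] by simp
        then have "\<not> even (card (S - {n}) + p)" using S by (metis (no_types, lifting) mem_Collect_eq add_Suc even_Suc)
        then show ?thesis unfolding if_not_P using True by auto
      next
        case False
        then show ?thesis using S by simp
      qed
    qed
    have B: "finite B \<and> n \<notin> B" if "B \<subseteq> {1..n - 1}" for B
      using that n by (auto intro: finite_subset)
    then show "\<forall>B\<in>?Y. (if even (card B + p) then B else insert n B) - {n} = B" by auto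
    show "(\<lambda>S. S - {n}) ` ?X \<subseteq> ?Y" by fastforce
    show "(\<lambda>B. if even (card B + p) then B else insert n B) ` ?Y \<subseteq> ?X"
    proof (rule image_subsetI)
      fix C assume C: "C \<in> ?Y"
      then have "finite C" "n \<notin> C" using B by auto
      moreover have "C \<subseteq> {1..n}" using C by fastforce
      ultimately show "(if even (card C + p) then C else insert n C) \<in> ?X"
        using C n by auto
    qed
  qed
  then show ?thesis using card_bounded_subsets [of "{1..n - 1}" t] by (simp add: bij_betw_same_card)
qed

text \<open>Bounding \<open>S - {n}\<close> instead of \<open>S\<close> could only add sets of size
  t + 1, and these have the wrong parity.\<close>

lemma card_bounded_same_parity_sets:
  assumes n: "n \<ge> 1"
  shows "card {S \<in> Pow {1..n}. even (card S + t) \<and> card S \<le> t} = (\<Sum>i=0..t. (n - 1) choose i)"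
proof -
  have "card S \<le> t \<longleftrightarrow> card (S - {n}) \<le> t" if "S \<subseteq> {1..n}" "even (card S + t)" for S
  proof (cases "n \<in> S")
    case True
    have "finite S" using that by (auto intro: finite_subset)
    then have "card S = Suc (card (S - {n}))" using card_Suc_Diff1 [of S n] True by simp
    then show ?thesis using that(2) by presburger
  qed simp
  then have "{S \<in> Pow {1..n}. even (card S + t) \<and> card S \<le> t}
      = {S \<in> Pow {1..n}. even (card S + t) \<and> card (S - {n}) \<le> t}" by auto
  then show ?thesis using card_parity_sets [OF n] by simp
qed

section \<open>The extremal family and the final bound\<close>

lemma even_card_sym_diff:
  assumes "finite A" "finite B" "even (card A)" "even (card B)"
  shows "even (card (sym_diff A B))"
proof -
  have "card (sym_diff A B) = card (A - B) + card (B - A)"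
    using assms by (intro card_Un_disjoint) auto
  moreover have "card A = card (A - B) + card (A \<inter> B)" "card B = card (B - A) + card (A \<inter> B)"
    using assms card_Diff_subset_Int [of A B] card_Diff_subset_Int [of B A]
      card_mono [of A "A \<inter> B"] card_mono [of B "A \<inter> B"]
    by (simp_all add: Int_commute)
  ultimately show ?thesis using assms(3,4) by presburger
qed

text \<open>Away from \<open>n\<close> two members differ in at most 2t points, and \<open>n\<close>
  may add one more. The resulting bound 2t + 1 is odd while the distance is even, so it drops to
  2t.\<close>

lemma distances_in_even_ball:
  "distances_in {A \<in> even_subcube n. card (A - {n}) \<le> t} ((\<lambda>i. 2 * i) ` {1..t})"
  unfolding distances_in_def
proof (intro ballI impI)
  fix A B
  assume A: "A \<in> {A \<in> even_subcube n. card (A - {n}) \<le> t}"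
    and B: "B \<in> {A \<in> even_subcube n. card (A - {n}) \<le> t}" and "A \<noteq> B"
  then have fin: "finite A" "finite B" by (auto simp: even_subcube_def intro: finite_subset)
  then have ev: "even (card (sym_diff A B))"
    using A B by (intro even_card_sym_diff) (auto simp: even_subcube_def)
  have "card (sym_diff A B) \<le> card (insert n ((A - {n}) \<union> (B - {n})))"
    using fin by (intro card_mono) auto
  also have "\<dots> \<le> Suc (card ((A - {n}) \<union> (B - {n})))" by (rule card_insert_le_m1) auto
  also have "\<dots> \<le> Suc (card (A - {n}) + card (B - {n}))" by (simp add: card_Un_le)
  also have "\<dots> \<le> Suc (2 * t)" using A B by simp
  finally have "card (sym_diff A B) \<le> Suc (2 * t)" .
  moreover have "card (sym_diff A B) > 0"
    using fin \<open>A \<noteq> B\<close> by (subst card_gt_0_iff) auto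
  moreover obtain k where "card (sym_diff A B) = 2 * k" using ev by (rule evenE)
  ultimately show "card (sym_diff A B) \<in> (\<lambda>i. 2 * i) ` {1..t}" by auto
qed

theorem theorem1p1:
  shows "\<exists>n0 :: nat set \<Rightarrow> nat.
    (\<forall>(t::nat) (l :: nat \<Rightarrow> nat).
        t \<ge> 1 \<longrightarrow> inj_on l {1..t} \<longrightarrow> (\<forall>i\<in>{1..t}. l i > 0) \<longrightarrow>
        (\<forall>n \<ge> n0 ((\<lambda>i. 2 * l i) ` {1..t}).
          \<forall>F \<subseteq> even_subcube n.
            distances_in F ((\<lambda>i. 2 * l i) ` {1..t}) \<longrightarrow>
            card F \<le> (\<Sum>i=0..t. (n - 1) choose i))) \<and>
    (\<forall>t::nat. t \<ge> 1 \<longrightarrow>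
        (\<forall>n \<ge> n0 ((\<lambda>i. 2 * i) ` {1..t}).
          \<exists>F \<subseteq> even_subcube n.
            distances_in F ((\<lambda>i. 2 * i) ` {1..t}) \<and>
            card F = (\<Sum>i=0..t. (n - 1) choose i)))"
\<comment> \<open>With distances d = 2 \<open>l i\<close>, the sign pattern needs 2d \<le> n for
  every d in L, which is what n \<ge> 2 \<open>Max L\<close> says.\<close>
proof (intro exI [of _ "\<lambda>L. 2 * Max L"] conjI allI impI)
  fix t n :: nat and l :: "nat \<Rightarrow> nat" and F
  let ?L = "(\<lambda>i. 2 * l i) ` {1..t}"
  assume t: "t \<ge> 1" and l: "\<forall>i\<in>{1..t}. l i > 0" and n: "n \<ge> 2 * Max ?L"
    and F: "F \<subseteq> even_subcube n" and dist: "distances_in F ?L"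
  have d: "0 < 2 * l i \<and> 2 * (2 * l i) \<le> n" if "i \<in> {1..t}" for i
  proof -
    have "2 * l i \<le> Max ?L" using that by (intro Max_ge) auto
    moreover have "l i > 0" using l that by blast
    ultimately show ?thesis using n by linarith
  qed
  have "n \<ge> 1" using d [of 1] t by simp
  have "card F \<le> card {S \<in> Pow {1..n}. even (card S + card {1..t}) \<and> card S \<le> card {1..t}}"
  proof (rule card_le_same_parity_sets)
    show "F \<subseteq> Pow {1..n}" using F by (auto simp: even_subcube_def)
    show "card (sym_diff A B) \<in> ?L" if "A \<in> F" "B \<in> F" "A \<noteq> B" for A B
      using dist that unfolding distances_in_def by blast
  qed (use d in auto)
  also have "\<dots> = (\<Sum>i=0..t. (n - 1) choose i)"
    using card_bounded_same_parity_sets [OF \<open>n \<ge> 1\<close>] by simp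
  finally show "card F \<le> (\<Sum>i=0..t. (n - 1) choose i)" .
next
  fix t n :: nat
  let ?L = "(\<lambda>i. 2 * i) ` {1..t}"
  let ?F = "{A \<in> even_subcube n. card (A - {n}) \<le> t}"
  assume t: "t \<ge> 1" and n: "n \<ge> 2 * Max ?L"
  have "2 * 1 \<le> Max ?L" using t by (intro Max_ge) auto
  then have "n \<ge> 1" using n by simp
  have "?F = {S \<in> Pow {1..n}. even (card S + 0) \<and> card (S - {n}) \<le> t}"
    by (auto simp: even_subcube_def)
  then have "card ?F = (\<Sum>i=0..t. (n - 1) choose i)"
    by (simp only: card_parity_sets [OF \<open>n \<ge> 1\<close>])
  then show "\<exists>F \<subseteq> even_subcube n. distances_in F ?L \<and> card F = (\<Sum>i=0..t. (n - 1) choose i)"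
    using distances_in_even_ball by (intro exI [of _ ?F]) auto
qed

end
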